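(* Fix positive integers $t\le a\le b$. Let $(A_1,B_1),\dots,(A_m,B_m)$ be a collection of pairs of sets with $|A_i|=a$ and $|B_i|=b$ for $1\le i\le m$. Suppose that (i) $A_i\cap B_i=\emptyset$ for $1\le i\le m$, (ii) $A_i\cap B_j\ne\emptyset$ for $1\le i<j\le m$, and (iii) $|A_i\cap A_j|\ge t$ for $1\le i,j\le m$. Then $m\le AK(a+b,a,t)$.
   Context: $[n]=\{1,\dots,n\}$. A family $\mathcal A$ of subsets of $[n]$ is $t$-intersecting if $|A\cap B|\ge t$ for all $A,B\in\mathcal A$ (including $A=B$), and $a$-uniform if all its members have exactly $a$ elements. $AK(n,a,t)$ denotes the maximum size of an $a$-uniform $t$-intersecting family of subsets of $[n]$. *)

theory Defs
  imports Main
begin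

definition t_intersecting :: "nat \<Rightarrow> 'a set set \<Rightarrow> bool" where
  "t_intersecting t F \<longleftrightarrow> (\<forall>A\<in>F. \<forall>B\<in>F. t \<le> card (A \<inter> B))"

definition uniform :: "nat \<Rightarrow> 'a set set \<Rightarrow> bool" where
  "uniform a F \<longleftrightarrow> (\<forall>A\<in>F. finite A \<and> card A = a)"

text \<open>The maximum is taken over a finite set of numbers, which contains 0 because of the
  empty family.\<close>

definition AK :: "nat \<Rightarrow> nat \<Rightarrow> nat \<Rightarrow> nat" where
  "AK n a t = Max {card F | F. F \<subseteq> Pow {1..n} \<and> uniform a F \<and> t_intersecting t F}"

end

theory Submission
  imports Defs Complex_Main "HOL-Library.Nat_Bijection"
begin

text \<open>
  Put \<open>n = a + b\<close>, place the ground elements as vectors in general position in \<open>\<real>\<^sup>n\<close>, and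
  represent a set by the wedge product of its vectors in the exterior algebra of \<open>\<real>\<^sup>n\<close>. Let
  \<open>\<alpha>\<^sub>i\<close> and \<open>\<beta>\<^sub>i\<close> stand for \<open>A\<^sub>i\<close> and \<open>B\<^sub>i\<close>. A product of at most \<open>n\<close> of the vectors vanishes
  exactly when one of them is repeated, so \<open>\<alpha>\<^sub>i \<and> \<beta>\<^sub>j = 0\<close> for \<open>i < j\<close> while
  \<open>\<alpha>\<^sub>i \<and> \<beta>\<^sub>i \<noteq> 0\<close>. By triangularity the \<open>\<alpha>\<^sub>i\<close> are linearly independent
  (\<open>skew_pairing_independent\<close>), and hence span a space \<open>W\<close> of dimension \<open>m\<close>.

  It remains to bound \<open>dim W\<close> by the size of a \<open>t\<close>-intersecting family of \<open>a\<close>-subsets of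
  \<open>{1..n}\<close>. The elements of \<open>W\<close> have coordinates indexed by these \<open>a\<close>-subsets. Order the subsets
  by \<open>set_encode\<close>, which gives \<open>i\<close> the weight \<open>2\<^sup>i\<close>, and let \<open>F\<close> be the family of leading sets of
  nonzero elements of \<open>W\<close>. An element of \<open>W\<close> that vanishes at every member of \<open>F\<close> is zero, so
  \<open>m \<le> |F|\<close> (\<open>card_le_leading_sets\<close>).

  Finally, \<open>F\<close> is \<open>t\<close>-intersecting. If \<open>|A\<^sub>i \<inter> A\<^sub>j| > |S|\<close>, then some nontrivial combination \<open>c\<close> of
  the vectors common to \<open>A\<^sub>i\<close> and \<open>A\<^sub>j\<close> has all its coordinates in \<open>S\<close> equal to zero. Such a \<open>c\<close>
  can be factored out of \<open>\<alpha>\<^sub>i\<close> and \<open>\<alpha>\<^sub>j\<close>, and survives as a factor when both are contracted by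
  the coordinates in \<open>S\<close>; so the two contractions have product zero
  (\<open>contract_wedge_list_intersecting\<close>). This condition is bilinear and therefore passes to all of
  \<open>W\<close>, for every \<open>S\<close> with fewer than \<open>t\<close> elements. On the other hand, if \<open>f\<close> and \<open>g\<close> have
  leading sets \<open>I\<close> and \<open>J\<close>, then contraction by \<open>S = I \<inter> J\<close> leaves the disjoint leading sets
  \<open>I - S\<close> and \<open>J - S\<close>, and these produce a nonzero coefficient of the product
  (\<open>contract_leading\<close>). Hence \<open>I \<inter> J\<close> has at least \<open>t\<close> elements.
\<close>

section \<open>Exterior multiplication in coordinates\<close>

text \<open>The sign of the permutation that sorts \<open>K\<close> followed by \<open>L\<close>, each in increasing order, when
  \<open>K\<close> and \<open>L\<close> are disjoint. As a product over pairs it is multiplicative in both arguments, which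
  turns every sign computation below into a splitting of sets.\<close>

definition inv_sign :: "nat set \<Rightarrow> nat set \<Rightarrow> real" where
  "inv_sign K L = (\<Prod>k\<in>K. \<Prod>l\<in>L. if l < k then -1 else 1)"

lemma inv_sign_Un_left:
  "finite K \<Longrightarrow> finite K' \<Longrightarrow> K \<inter> K' = {} \<Longrightarrow> inv_sign (K \<union> K') L = inv_sign K L * inv_sign K' L"
  by (simp add: inv_sign_def prod.union_disjoint)

lemma inv_sign_Un_right:
  "finite L \<Longrightarrow> finite L' \<Longrightarrow> L \<inter> L' = {} \<Longrightarrow> inv_sign K (L \<union> L') = inv_sign K L * inv_sign K L'"
  by (simp add: inv_sign_def prod.union_disjoint prod.distrib)

lemma inv_sign_nonzero: "inv_sign K L \<noteq> 0"
  by (cases "finite K"; cases "finite L") (auto simp: inv_sign_def)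

lemma inv_sign_swap_singletons: "j \<noteq> k \<Longrightarrow> inv_sign {k} {j} = - inv_sign {j} {k}"
  by (auto simp: inv_sign_def)

lemma inv_sign_swap: "finite K \<Longrightarrow> j \<notin> K \<Longrightarrow> inv_sign K {j} = (-1) ^ card K * inv_sign {j} K"
proof (induction K rule: finite_induct)
  case (insert k K)
  have "inv_sign (insert k K) {j} = inv_sign {k} {j} * inv_sign K {j}"
    "inv_sign {j} (insert k K) = inv_sign {j} {k} * inv_sign {j} K"
    using insert.hyps inv_sign_Un_left[of "{k}" K] inv_sign_Un_right[of "{k}" K] by auto
  then show ?case using insert inv_sign_swap_singletons[of j k] by simp
qed (simp add: inv_sign_def)

text \<open>An element of the exterior algebra is given by its coordinates in the standard basis of
  sorted monomials, indexed by finite subsets of \<open>\<nat>\<close>. Left multiplication by a vector \<open>c\<close> has its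
  own definition: all algebra needed here reduces to how these operators interact with each
  other and with the product.\<close>

definition vec_wedge :: "(nat \<Rightarrow> real) \<Rightarrow> (nat set \<Rightarrow> real) \<Rightarrow> nat set \<Rightarrow> real" where
  "vec_wedge c f T = (\<Sum>j\<in>T. inv_sign {j} (T - {j}) * c j * f (T - {j}))"

definition wedge :: "(nat set \<Rightarrow> real) \<Rightarrow> (nat set \<Rightarrow> real) \<Rightarrow> nat set \<Rightarrow> real" where
  "wedge f g T = (\<Sum>K\<in>Pow T. inv_sign K (T - K) * f K * g (T - K))"

lemma vec_wedge_infinite: "infinite T \<Longrightarrow> vec_wedge c f T = 0"
  by (simp add: vec_wedge_def)

lemma wedge_infinite: "infinite T \<Longrightarrow> wedge f g T = 0"
  by (simp add: wedge_def)

lemma vec_wedge_scale: "vec_wedge c (\<lambda>K. r * f K) = (\<lambda>T. r * vec_wedge c f T)"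
  by (rule ext) (simp add: vec_wedge_def sum_distrib_left mult_ac)

lemma vec_wedge_zero: "vec_wedge c (\<lambda>K. 0) = (\<lambda>T. 0)"
  by (rule ext) (simp add: vec_wedge_def)

lemma vec_wedge_sum_left: "vec_wedge (\<lambda>k. \<Sum>x\<in>C. r x * v x k) f T = (\<Sum>x\<in>C. r x * vec_wedge (v x) f T)"
  unfolding vec_wedge_def sum_distrib_left sum_distrib_right
  by (subst sum.swap) (simp add: mult_ac)

lemma vec_wedge_anticommute: "vec_wedge c (vec_wedge d f) = (\<lambda>T. - vec_wedge d (vec_wedge c f) T)"
proof
  fix T
  show "vec_wedge c (vec_wedge d f) T = - vec_wedge d (vec_wedge c f) T"
  proof (cases "finite T")
    case fin: True
    have expand: "vec_wedge c (vec_wedge d f) T = (\<Sum>(j,k)\<in>(SIGMA j:T. T - {j}).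
        inv_sign {j} (T - {j}) * c j * (inv_sign {k} (T - {j} - {k}) * d k * f (T - {j} - {k})))" for c d
      unfolding vec_wedge_def sum_distrib_left using fin by (simp add: sum.Sigma)
    have "- vec_wedge d (vec_wedge c f) T = (\<Sum>(j,k)\<in>(SIGMA j:T. T - {j}).
        - (inv_sign {j} (T - {j}) * d j * (inv_sign {k} (T - {j} - {k}) * c k * f (T - {j} - {k}))))"
      unfolding expand by (simp add: sum_negf case_prod_unfold)
    also have "\<dots> = vec_wedge c (vec_wedge d f) T"
      unfolding expand
    proof (rule sum.reindex_bij_witness[where i="\<lambda>(j,k). (k,j)" and j="\<lambda>(j,k). (k,j)"])
      fix p assume "p \<in> (SIGMA j:T. T - {j})"
      then obtain j k where p: "p = (j, k)" and *: "j \<in> T" "k \<in> T" "k \<noteq> j" by auto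
      let ?R = "T - {j} - {k}"
      have R: "T - {j} = {k} \<union> ?R" "T - {k} = {j} \<union> ?R" "T - {k} - {j} = ?R" using * by auto
      have "inv_sign {j} (T - {j}) = inv_sign {j} {k} * inv_sign {j} ?R"
        using inv_sign_Un_right[of "{k}" ?R "{j}"] fin R(1) by simp
      moreover have "inv_sign {k} (T - {k}) = inv_sign {k} {j} * inv_sign {k} ?R"
        using inv_sign_Un_right[of "{j}" ?R "{k}"] fin R(2) by simp
      ultimately show "(case case p of (j, k) \<Rightarrow> (k, j) of (j, k) \<Rightarrow>
            inv_sign {j} (T - {j}) * c j * (inv_sign {k} (T - {j} - {k}) * d k * f (T - {j} - {k})))
          = (case p of (j, k) \<Rightarrow>
            - (inv_sign {j} (T - {j}) * d j * (inv_sign {k} (T - {j} - {k}) * c k * f (T - {j} - {k}))))"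
        using * R(3) p inv_sign_swap_singletons[of j k] by simp
    qed auto
    finally show ?thesis by simp
  qed (simp add: vec_wedge_infinite)
qed

lemma vec_wedge_vec_wedge_same: "vec_wedge c (vec_wedge c f) = (\<lambda>T. 0)"
proof
  fix T show "vec_wedge c (vec_wedge c f) T = 0"
    using fun_cong[OF vec_wedge_anticommute[of c c f], of T] by simp
qed

lemma wedge_vec_wedge_left: "wedge (vec_wedge c f) g = vec_wedge c (wedge f g)"
proof
  fix T
  show "wedge (vec_wedge c f) g T = vec_wedge c (wedge f g) T"
  proof (cases "finite T")
    case fin: True
    have finK: "finite K" if "K \<subseteq> T" for K using that fin finite_subset by blast
    have "wedge (vec_wedge c f) g T = (\<Sum>(K,j)\<in>(SIGMA K:Pow T. K).
        inv_sign K (T - K) * (inv_sign {j} (K - {j}) * c j * f (K - {j})) * g (T - K))"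
      unfolding wedge_def vec_wedge_def sum_distrib_left sum_distrib_right
      using fin finK by (simp add: sum.Sigma)
    also have "\<dots> = (\<Sum>(j,K)\<in>(SIGMA j:T. Pow (T - {j})).
        inv_sign {j} (T - {j}) * c j * (inv_sign K (T - {j} - K) * f K * g (T - {j} - K)))"
    proof (rule sum.reindex_bij_witness[where i="\<lambda>(j,K). (insert j K, j)" and j="\<lambda>(K,j). (j, K - {j})"])
      fix p assume "p \<in> (SIGMA K:Pow T. K)"
      then obtain K j where p: "p = (K, j)" and K: "K \<subseteq> T" and j: "j \<in> K" by auto
      let ?K = "K - {j}"
      have eq: "T - {j} - ?K = T - K" "{j} \<union> ?K = K" "?K \<union> (T - K) = T - {j}" using K j by auto
      have "inv_sign K (T - K) = inv_sign {j} (T - K) * inv_sign ?K (T - K)"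
        using inv_sign_Un_left[of "{j}" ?K] finK[OF K] eq by simp
      moreover have "inv_sign {j} (T - {j}) = inv_sign {j} ?K * inv_sign {j} (T - K)"
        using inv_sign_Un_right[of ?K "T - K" "{j}"] fin finK[OF K] eq by auto
      ultimately show "(case case p of (K, j) \<Rightarrow> (j, K - {j}) of (j, K) \<Rightarrow>
          inv_sign {j} (T - {j}) * c j * (inv_sign K (T - {j} - K) * f K * g (T - {j} - K)))
        = (case p of (K, j) \<Rightarrow> inv_sign K (T - K) * (inv_sign {j} (K - {j}) * c j * f (K - {j})) * g (T - K))"
        using eq p by simp
    qed auto
    also have "\<dots> = vec_wedge c (wedge f g) T"
      unfolding wedge_def vec_wedge_def sum_distrib_left using fin by (simp add: sum.Sigma)
    finally show ?thesis .
  qed (simp add: vec_wedge_infinite wedge_infinite)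
qed

text \<open>Moving a vector past an element of degree \<open>d\<close> costs the sign \<open>(-1)\<^sup>d\<close>. The factor
  \<open>(-1) ^ card K\<close> applies this in each degree separately, so that no homogeneity of \<open>f\<close> has to be
  carried along.\<close>

lemma wedge_vec_wedge_right: "wedge f (vec_wedge c g) = vec_wedge c (wedge (\<lambda>K. (-1) ^ card K * f K) g)"
proof
  fix T
  show "wedge f (vec_wedge c g) T = vec_wedge c (wedge (\<lambda>K. (-1) ^ card K * f K) g) T"
  proof (cases "finite T")
    case fin: True
    have finK: "finite K" if "K \<subseteq> T" for K using that fin finite_subset by blast
    have "wedge f (vec_wedge c g) T = (\<Sum>(K,j)\<in>(SIGMA K:Pow T. T - K).
        inv_sign K (T - K) * f K * (inv_sign {j} (T - K - {j}) * c j * g (T - K - {j})))"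
      unfolding wedge_def vec_wedge_def sum_distrib_left
      using fin finK by (simp add: sum.Sigma)
    also have "\<dots> = (\<Sum>(j,K)\<in>(SIGMA j:T. Pow (T - {j})).
        inv_sign {j} (T - {j}) * c j * (inv_sign K (T - {j} - K) * ((-1) ^ card K * f K) * g (T - {j} - K)))"
    proof (rule sum.reindex_bij_witness[where i="\<lambda>(j,K). (K, j)" and j="\<lambda>(K,j). (j, K)"])
      fix p assume "p \<in> (SIGMA K:Pow T. T - K)"
      then obtain K j where p: "p = (K, j)" and K: "K \<subseteq> T" and j: "j \<in> T" "j \<notin> K" by auto
      let ?R = "T - {j} - K"
      have eq: "T - K - {j} = ?R" "{j} \<union> ?R = T - K" "K \<union> ?R = T - {j}" using K j by auto
      have "inv_sign K (T - K) = inv_sign K {j} * inv_sign K ?R"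
        using inv_sign_Un_right[of "{j}" ?R K] fin eq by simp
      moreover have "inv_sign {j} (T - {j}) = inv_sign {j} K * inv_sign {j} ?R"
        using inv_sign_Un_right[of K ?R "{j}"] fin finK[OF K] eq by auto
      ultimately show "(case case p of (K, j) \<Rightarrow> (j, K) of (j, K) \<Rightarrow>
          inv_sign {j} (T - {j}) * c j * (inv_sign K (T - {j} - K) * ((-1) ^ card K * f K) * g (T - {j} - K)))
        = (case p of (K, j) \<Rightarrow> inv_sign K (T - K) * f K * (inv_sign {j} (T - K - {j}) * c j * g (T - K - {j})))"
        using eq(1) p inv_sign_swap[OF finK[OF K] j(2)] by simp
    qed auto
    also have "\<dots> = vec_wedge c (wedge (\<lambda>K. (-1) ^ card K * f K) g) T"
      unfolding wedge_def vec_wedge_def sum_distrib_left using fin by (simp add: sum.Sigma)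
    finally show ?thesis .
  qed (simp add: vec_wedge_infinite wedge_infinite)
qed

lemma wedge_common_factor: "wedge (vec_wedge c f) (vec_wedge c g) = (\<lambda>T. 0)"
  unfolding wedge_vec_wedge_left wedge_vec_wedge_right[of f] by (rule vec_wedge_vec_wedge_same)

lemma wedge_combination:
  "wedge (\<lambda>K. \<Sum>i\<in>I. r i * f i K) (\<lambda>K. \<Sum>j\<in>J. s j * g j K) T
    = (\<Sum>i\<in>I. \<Sum>j\<in>J. r i * s j * wedge (f i) (g j) T)"
proof -
  have "wedge (\<lambda>K. \<Sum>i\<in>I. r i * f i K) (\<lambda>K. \<Sum>j\<in>J. s j * g j K) T
    = (\<Sum>K\<in>Pow T. \<Sum>i\<in>I. \<Sum>j\<in>J. r i * s j * (inv_sign K (T - K) * f i K * g j (T - K)))"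
    unfolding wedge_def sum_distrib_left sum_distrib_right
    by (subst (2) sum.swap) (simp add: mult_ac)
  also have "\<dots> = (\<Sum>i\<in>I. \<Sum>K\<in>Pow T. \<Sum>j\<in>J. r i * s j * (inv_sign K (T - K) * f i K * g j (T - K)))"
    by (rule sum.swap)
  also have "\<dots> = (\<Sum>i\<in>I. \<Sum>j\<in>J. r i * s j * wedge (f i) (g j) T)"
    unfolding wedge_def sum_distrib_left by (subst sum.swap) simp
  finally show ?thesis .
qed

section \<open>Contraction by a set of coordinates\<close>

text \<open>Up to signs, this is the iterated interior product with the coordinate functionals in \<open>S\<close>.
  The omitted signs depend on \<open>K\<close>; they reappear in \<open>contract_vec_wedge\<close> as a rescaling of the
  coordinates of \<open>c\<close>.\<close>

definition contract :: "nat set \<Rightarrow> (nat set \<Rightarrow> real) \<Rightarrow> nat set \<Rightarrow> real" where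
  "contract S f K = (if K \<inter> S = {} then f (K \<union> S) else 0)"

text \<open>A vector without coordinates in \<open>S\<close> passes through the contraction: the index \<open>j\<close> that it
  contributes to \<open>K \<union> S\<close> always lies in \<open>K\<close>.\<close>

lemma contract_vec_wedge:
  assumes S: "finite S" and c: "\<And>i. i \<in> S \<Longrightarrow> c i = 0"
  shows "contract S (vec_wedge c f) = vec_wedge (\<lambda>j. inv_sign {j} S * c j) (contract S f)"
proof
  fix K
  let ?c = "\<lambda>j. inv_sign {j} S * c j"
  show "contract S (vec_wedge c f) K = vec_wedge ?c (contract S f) K"
  proof (cases "finite K \<and> K \<inter> S = {}")
    case True
    then have "vec_wedge c f (K \<union> S)
        = (\<Sum>j\<in>K. inv_sign {j} (K \<union> S - {j}) * c j * f (K \<union> S - {j}))"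
      unfolding vec_wedge_def using S c by (subst sum.union_disjoint) auto
    also have "\<dots> = (\<Sum>j\<in>K. inv_sign {j} (K - {j}) * ?c j * contract S f (K - {j}))"
    proof (rule sum.cong[OF refl])
      fix j assume j: "j \<in> K"
      have "K \<union> S - {j} = (K - {j}) \<union> S" using True j by auto
      then show "inv_sign {j} (K \<union> S - {j}) * c j * f (K \<union> S - {j})
          = inv_sign {j} (K - {j}) * ?c j * contract S f (K - {j})"
        using inv_sign_Un_right[of "K - {j}" S "{j}"] True S by (auto simp: contract_def)
    qed
    finally show ?thesis using True by (simp add: contract_def vec_wedge_def)
  next
    case False
    have "?c j * contract S f (K - {j}) = 0" if "K \<inter> S \<noteq> {}" for j
      using that c by (cases "j \<in> S") (auto simp: contract_def)
    then have "vec_wedge ?c (contract S f) K = 0" if "K \<inter> S \<noteq> {}"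
      unfolding vec_wedge_def using that by (intro sum.neutral) (simp add: mult.assoc)
    then show ?thesis using False by (auto simp: contract_def vec_wedge_infinite)
  qed
qed

section \<open>Products of vectors\<close>

text \<open>The product of the vectors of a set is determined only up to sign; a list fixes the sign.\<close>

fun wedge_list :: "('v \<Rightarrow> nat \<Rightarrow> real) \<Rightarrow> 'v list \<Rightarrow> nat set \<Rightarrow> real" where
  "wedge_list v [] = (\<lambda>K. if K = {} then 1 else 0)"
| "wedge_list v (x # xs) = vec_wedge (v x) (wedge_list v xs)"

lemma wedge_list_cong:
  "(\<And>x. x \<in> set xs \<Longrightarrow> v x = w x) \<Longrightarrow> wedge_list v xs = wedge_list w xs"
  by (induction xs) auto

lemma wedge_list_append: "wedge (wedge_list v xs) (wedge_list v ys) = wedge_list v (xs @ ys)"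
proof (induction xs)
  case Nil
  show ?case
  proof
    fix T
    show "wedge (wedge_list v []) (wedge_list v ys) T = wedge_list v ([] @ ys) T"
    proof (cases "finite T")
      case True
      have "wedge (wedge_list v []) (wedge_list v ys) T
          = (\<Sum>K\<in>Pow T. if K = {} then wedge_list v ys T else 0)"
        unfolding wedge_def by (intro sum.cong) (auto simp: inv_sign_def)
      then show ?thesis using True by simp
    next
      case False
      then show ?thesis by (cases ys) (auto simp: wedge_infinite vec_wedge_infinite)
    qed
  qed
qed (simp add: wedge_vec_wedge_left)

lemma wedge_list_move:
  "\<exists>s. (s = 1 \<or> s = -1) \<and> wedge_list v (xs @ x # ys) = (\<lambda>T. s * wedge_list v (x # xs @ ys) T)"
proof (induction xs)
  case Nil
  then show ?case by (intro exI[of _ 1]) simp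
next
  case (Cons y xs)
  then obtain s where s: "s = 1 \<or> s = -1"
    and "wedge_list v (xs @ x # ys) = (\<lambda>T. s * wedge_list v (x # xs @ ys) T)" by blast
  then have "wedge_list v ((y # xs) @ x # ys)
      = (\<lambda>T. s * vec_wedge (v y) (vec_wedge (v x) (wedge_list v (xs @ ys))) T)"
    by (simp add: vec_wedge_scale)
  also have "\<dots> = (\<lambda>T. (- s) * wedge_list v (x # (y # xs) @ ys) T)"
    by (simp add: vec_wedge_anticommute[of "v y"])
  finally show ?case using s by (intro exI[of _ "- s"]) auto
qed

lemma wedge_list_repeated: "x \<in> set xs \<Longrightarrow> vec_wedge (v x) (wedge_list v xs) = (\<lambda>T. 0)"
proof -
  assume "x \<in> set xs"
  then obtain ys zs where xs: "xs = ys @ x # zs" by (auto simp: in_set_conv_decomp)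
  obtain s where "wedge_list v xs = (\<lambda>T. s * wedge_list v (x # ys @ zs) T)"
    using wedge_list_move[of v ys x zs] xs by blast
  then show ?thesis by (simp add: vec_wedge_scale vec_wedge_vec_wedge_same)
qed

lemma wedge_list_not_distinct: "\<not> distinct xs \<Longrightarrow> wedge_list v xs = (\<lambda>T. 0)"
  by (induction xs) (auto simp: wedge_list_repeated vec_wedge_zero)

lemma wedge_list_support:
  assumes "\<And>x k. x \<in> set xs \<Longrightarrow> k \<notin> N \<Longrightarrow> v x k = 0" and "wedge_list v xs K \<noteq> 0"
  shows "finite K \<and> K \<subseteq> N \<and> card K = length xs"
  using assms
proof (induction xs arbitrary: K)
  case Nil
  then show ?case by (auto split: if_splits)
next
  case (Cons x xs)
  from Cons.prems(2)
  have "(\<Sum>j\<in>K. inv_sign {j} (K - {j}) * v x j * wedge_list v xs (K - {j})) \<noteq> 0"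
    by (simp add: vec_wedge_def)
  then obtain j where "j \<in> K" "inv_sign {j} (K - {j}) * v x j * wedge_list v xs (K - {j}) \<noteq> 0"
    by (rule sum.not_neutral_contains_not_neutral)
  then have j: "j \<in> K" "v x j \<noteq> 0" "wedge_list v xs (K - {j}) \<noteq> 0" by auto
  have K: "finite (K - {j}) \<and> K - {j} \<subseteq> N \<and> card (K - {j}) = length xs"
    using Cons.IH[OF _ j(3)] Cons.prems(1) by simp
  moreover have "finite K" using K finite_Diff2[of "{j}" K] by blast
  moreover have "j \<in> N" using Cons.prems(1)[of x j] j(2) by auto
  ultimately show ?case using j(1) card_Suc_Diff1[of K j] by auto
qed

section \<open>Factoring out a common vector\<close>

text \<open>Gaussian elimination: a homogeneous linear system with more unknowns than equations has a
  nontrivial solution.\<close>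

lemma homogeneous_system:
  fixes M :: "'x \<Rightarrow> 'i \<Rightarrow> real"
  assumes "finite S" "finite C" "card S < card C"
  shows "\<exists>r. (\<exists>x\<in>C. r x \<noteq> 0) \<and> (\<forall>i\<in>S. (\<Sum>x\<in>C. r x * M x i) = 0)"
  using assms
proof (induction S arbitrary: C M rule: finite_induct)
  case empty
  then have "C \<noteq> {}" by auto
  then show ?case by (intro exI[of _ "\<lambda>_. 1"]) auto
next
  case (insert i S)
  show ?case
  proof (cases "\<forall>x\<in>C. M x i = 0")
    case True
    have "card S < card C" using insert by simp
    from insert.IH[OF insert.prems(1) this, of M] True show ?thesis by auto
  next
    case False
    then obtain z where z: "z \<in> C" "M z i \<noteq> 0" by blast
    have "card S < card (C - {z})" using insert z by simp
    from insert.IH[OF _ this, of "\<lambda>x k. M x k - M x i / M z i * M z k"] insert.prems(1)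
    obtain r x where r: "x \<in> C - {z}" "r x \<noteq> 0"
      "\<And>k. k \<in> S \<Longrightarrow> (\<Sum>x\<in>C - {z}. r x * (M x k - M x i / M z i * M z k)) = 0" by auto
    \<comment> \<open>Giving the eliminated unknown \<open>z\<close> the value \<open>- q\<close> makes equation \<open>i\<close> hold.\<close>
    define q where "q = (\<Sum>x\<in>C - {z}. r x * M x i) / M z i"
    define r' where "r' = r(z := - q)"
    have split: "(\<Sum>x\<in>C. r' x * M x k) = (\<Sum>x\<in>C - {z}. r x * M x k) - q * M z k" for k
    proof -
      have "(\<Sum>x\<in>C. r' x * M x k) = r' z * M z k + (\<Sum>x\<in>C - {z}. r' x * M x k)"
        using insert.prems(1) z(1) by (rule sum.remove)
      also have "(\<Sum>x\<in>C - {z}. r' x * M x k) = (\<Sum>x\<in>C - {z}. r x * M x k)"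
        by (rule sum.cong) (auto simp: r'_def)
      finally show ?thesis by (simp add: r'_def)
    qed
    have "(\<Sum>x\<in>C. r' x * M x k) = (\<Sum>x\<in>C - {z}. r x * (M x k - M x i / M z i * M z k))" for k
      unfolding split q_def sum_divide_distrib sum_distrib_right sum_subtractf[symmetric]
      by (intro sum.cong) (simp_all add: algebra_simps)
    then have "(\<Sum>x\<in>C. r' x * M x k) = 0" if "k \<in> S" for k
      using r(3)[OF that] by simp
    moreover have "(\<Sum>x\<in>C. r' x * M x i) = 0"
      unfolding split q_def using z(2) by simp
    moreover have "r' x \<noteq> 0" using r by (auto simp: r'_def)
    ultimately show ?thesis using r(1) by (intro exI[of _ r']) auto
  qed
qed

text \<open>Replacing \<open>v x\<close> by \<open>r x\<close> times itself plus multiples of other factors only rescales the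
  product, because the multiples create repeated factors.\<close>

lemma wedge_list_factor:
  assumes x: "x \<in> C" "r x \<noteq> 0" and C: "finite C" "C \<subseteq> set xs"
  shows "\<exists>f. wedge_list v xs = vec_wedge (\<lambda>k. \<Sum>y\<in>C. r y * v y k) f"
proof (cases "distinct xs")
  case False
  then show ?thesis by (intro exI[of _ "\<lambda>T. 0"]) (simp add: vec_wedge_zero wedge_list_not_distinct)
next
  case True
  obtain ys zs where xs: "xs = ys @ x # zs" using x C by (meson split_list subsetD)
  obtain s where s: "wedge_list v xs = (\<lambda>T. s * wedge_list v (x # ys @ zs) T)"
    using wedge_list_move[of v ys x zs] xs by blast
  let ?g = "wedge_list v (ys @ zs)"
  have "vec_wedge (\<lambda>k. \<Sum>y\<in>C. r y * v y k) ?g T = r x * vec_wedge (v x) ?g T" for T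
  proof -
    have "vec_wedge (v y) ?g = (\<lambda>T. 0)" if "y \<in> C - {x}" for y
      using that C xs by (intro wedge_list_repeated) auto
    then show ?thesis
      unfolding vec_wedge_sum_left using C(1) x(1) by (simp add: sum.remove)
  qed
  then have "wedge_list v xs = vec_wedge (\<lambda>k. \<Sum>y\<in>C. r y * v y k) (\<lambda>T. s / r x * ?g T)"
    unfolding vec_wedge_scale s using x(2) by simp
  then show ?thesis by blast
qed

text \<open>The \<open>card S\<close> linear conditions on the coordinates in \<open>S\<close> can be met by a nontrivial combination
  of the common vectors, as there are more than \<open>card S\<close> of them.\<close>

lemma contract_wedge_list_intersecting:
  assumes S: "finite S" and card: "card S < card (set xs \<inter> set ys)"
  shows "wedge (contract S (wedge_list v xs)) (contract S (wedge_list v ys)) = (\<lambda>T. 0)"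
proof -
  let ?C = "set xs \<inter> set ys"
  obtain r x where x: "x \<in> ?C" "r x \<noteq> 0" and r: "\<And>i. i \<in> S \<Longrightarrow> (\<Sum>y\<in>?C. r y * v y i) = 0"
    using homogeneous_system[OF S _ card, of v] by auto
  define c where "c = (\<lambda>k. \<Sum>y\<in>?C. r y * v y k)"
  obtain f g where "wedge_list v xs = vec_wedge c f" "wedge_list v ys = vec_wedge c g"
    using wedge_list_factor[of x ?C r xs v] wedge_list_factor[of x ?C r ys v] x
    unfolding c_def by auto
  moreover have "c i = 0" if "i \<in> S" for i using r that by (simp add: c_def)
  ultimately show ?thesis using S by (simp add: contract_vec_wedge wedge_common_factor)
qed

section \<open>Vectors in general position\<close>

text \<open>Seen as a function of \<open>z\<close>, a coordinate of the product of the moment curve point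
  \<open>(z, z\<^sup>2, \<dots>, z\<^sup>n)\<close> with \<open>f\<close> is a polynomial. If \<open>K\<close> misses some \<open>j\<close>, then the coordinate at
  \<open>insert j K\<close> has a nonzero coefficient at \<open>z\<^sup>j\<close>, and so only finitely many zeros.\<close>

lemma moment_curve_point:
  assumes K: "f K \<noteq> 0" "K \<subseteq> {1..n}" "card K < n"
  shows "finite {z. vec_wedge (\<lambda>k. if k \<in> {1..n} then z ^ k else 0) f = (\<lambda>T. 0)}"
proof -
  have finK: "finite K" using K(2) finite_subset by blast
  have "\<not> {1..n} \<subseteq> K" using K(3) finK card_mono[of K "{1..n}"] by auto
  then obtain j where j: "j \<in> {1..n}" "j \<notin> K" by blast
  define T where "T = insert j K"
  have T: "T \<subseteq> {1..n}" "finite T" "j \<in> T" "T - {j} = K" using j K(2) finK by (auto simp: T_def)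
  define q where "q i = (if i \<in> T then inv_sign {i} (T - {i}) * f (T - {i}) else 0)" for i
  have eval: "vec_wedge (\<lambda>k. if k \<in> {1..n} then z ^ k else 0) f T = (\<Sum>i\<le>n. q i * z ^ i)" for z
  proof -
    have "vec_wedge (\<lambda>k. if k \<in> {1..n} then z ^ k else 0) f T = (\<Sum>i\<in>T. q i * z ^ i)"
      unfolding vec_wedge_def using T(1) by (intro sum.cong) (auto simp: q_def)
    also have "\<dots> = (\<Sum>i\<le>n. q i * z ^ i)"
      using T(1) by (intro sum.mono_neutral_left) (auto simp: q_def)
    finally show ?thesis .
  qed
  have "q j \<noteq> 0" "j \<le> n" using j T K(1) by (auto simp: q_def inv_sign_nonzero)
  then have "finite {z. (\<Sum>i\<le>n. q i * z ^ i) = 0}"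
    using polyfun_finite_roots[of q n] by blast
  moreover have "{z. vec_wedge (\<lambda>k. if k \<in> {1..n} then z ^ k else 0) f = (\<lambda>T. 0)}
      \<subseteq> {z. (\<Sum>i\<le>n. q i * z ^ i) = 0}"
    using eval by (auto dest: fun_cong[of _ _ T])
  ultimately show ?thesis by (rule finite_subset[rotated])
qed

text \<open>The vectors are chosen one by one on the moment curve: a new one has to avoid, for each of
  the finitely many shorter products of the old ones, the finitely many parameters that
  annihilate it.\<close>

lemma general_position:
  assumes "finite X"
  shows "\<exists>v :: 'v \<Rightarrow> nat \<Rightarrow> real. (\<forall>x k. k \<notin> {1..n} \<longrightarrow> v x k = 0) \<and>
    (\<forall>xs. distinct xs \<longrightarrow> set xs \<subseteq> X \<longrightarrow> length xs \<le> n \<longrightarrow> wedge_list v xs \<noteq> (\<lambda>T. 0))"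
  using assms
proof (induction X rule: finite_induct)
  case empty
  have "wedge_list (\<lambda>_ _. 0) ([]::'v list) {} \<noteq> 0" by simp
  then show ?case by (intro exI[of _ "\<lambda>_ _. 0"]) (auto simp: fun_eq_iff)
next
  case (insert x X)
  then obtain v :: "'v \<Rightarrow> nat \<Rightarrow> real" where v0: "\<And>x k. k \<notin> {1..n} \<Longrightarrow> v x k = 0"
    and v: "\<And>xs. distinct xs \<Longrightarrow> set xs \<subseteq> X \<Longrightarrow> length xs \<le> n \<Longrightarrow> wedge_list v xs \<noteq> (\<lambda>T. 0)"
    by blast
  define u :: "real \<Rightarrow> nat \<Rightarrow> real" where "u z = (\<lambda>k. if k \<in> {1..n} then z ^ k else 0)" for z
  define LL where "LL = {xs. distinct xs \<and> set xs \<subseteq> X \<and> length xs < n}"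
  have "finite LL"
    unfolding LL_def by (rule finite_subset[OF _ finite_lists_length_le[OF insert.hyps(1), of n]]) auto
  moreover have "finite {z. vec_wedge (u z) (wedge_list v xs) = (\<lambda>T. 0)}" if "xs \<in> LL" for xs
  proof -
    obtain K where K: "wedge_list v xs K \<noteq> 0"
      using v[of xs] \<open>xs \<in> LL\<close> by (auto simp: LL_def fun_eq_iff)
    then have "K \<subseteq> {1..n}" "card K < n"
      using wedge_list_support[of xs "{1..n}" v K] v0 \<open>xs \<in> LL\<close> by (auto simp: LL_def)
    then show ?thesis unfolding u_def by (rule moment_curve_point[where f="wedge_list v xs", OF K])
  qed
  ultimately have "finite (\<Union>xs\<in>LL. {z. vec_wedge (u z) (wedge_list v xs) = (\<lambda>T. 0)})" by blast
  then obtain z where z: "\<And>xs. xs \<in> LL \<Longrightarrow> vec_wedge (u z) (wedge_list v xs) \<noteq> (\<lambda>T. 0)"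
    using ex_new_if_finite[OF infinite_UNIV_char_0] by blast
  define w where "w = v(x := u z)"
  have "wedge_list w xs \<noteq> (\<lambda>T. 0)"
    if xs: "distinct xs" "set xs \<subseteq> insert x X" "length xs \<le> n" for xs
  proof (cases "x \<in> set xs")
    case False
    then have "wedge_list w xs = wedge_list v xs" by (intro wedge_list_cong) (auto simp: w_def)
    then show ?thesis using v[of xs] xs False by auto
  next
    case True
    then obtain ys zs where split: "xs = ys @ x # zs" by (meson split_list)
    have "wedge_list w (ys @ zs) = wedge_list v (ys @ zs)"
      using xs split by (intro wedge_list_cong) (auto simp: w_def)
    then have "wedge_list w (x # ys @ zs) = vec_wedge (u z) (wedge_list v (ys @ zs))"
      by (simp add: w_def)
    moreover have "ys @ zs \<in> LL" using xs split by (auto simp: LL_def)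
    ultimately have "wedge_list w (x # ys @ zs) \<noteq> (\<lambda>T. 0)" using z by simp
    moreover obtain s where "s = 1 \<or> s = -1"
      "wedge_list w xs = (\<lambda>T. s * wedge_list w (x # ys @ zs) T)"
      using wedge_list_move[of w ys x zs] split by blast
    ultimately show ?thesis by (auto simp: fun_eq_iff)
  qed
  moreover have "w y k = 0" if "k \<notin> {1..n}" for y k using v0 that by (auto simp: w_def u_def)
  ultimately show ?case by blast
qed

section \<open>Leading sets\<close>

text \<open>Any injective weight that is additive on disjoint unions would serve; \<open>set_encode\<close>, with
  the weight \<open>2\<^sup>k\<close> for the element \<open>k\<close>, is one.\<close>

definition leading :: "(nat set \<Rightarrow> real) \<Rightarrow> nat set \<Rightarrow> bool" where
  "leading f K \<longleftrightarrow> finite K \<and> f K \<noteq> 0 \<and>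
     (\<forall>J. f J \<noteq> 0 \<longrightarrow> finite J \<and> set_encode J \<le> set_encode K)"

lemma leading_exists:
  assumes "finite N" "\<And>K. f K \<noteq> 0 \<Longrightarrow> K \<subseteq> N" "f \<noteq> (\<lambda>K. 0)"
  shows "\<exists>K. leading f K"
proof -
  let ?P = "{K. f K \<noteq> 0}"
  have sub: "?P \<subseteq> Pow N" using assms(2) by auto
  then have fin: "finite ?P" using assms(1) finite_subset by blast
  moreover have "?P \<noteq> {}" using assms(3) by (auto simp: fun_eq_iff)
  ultimately have "Max (set_encode ` ?P) \<in> set_encode ` ?P" by (intro Max_in) auto
  then obtain K where K: "K \<in> ?P" "Max (set_encode ` ?P) = set_encode K" by auto
  have "set_encode J \<le> set_encode K" if "f J \<noteq> 0" for J
    using that fin K(2) by (metis (mono_tags) Max_ge finite_imageI imageI mem_Collect_eq)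
  moreover have "finite J" if "f J \<noteq> 0" for J
    using assms(1,2) that finite_subset by blast
  ultimately show ?thesis using K(1) unfolding leading_def by auto
qed

lemma set_encode_Un:
  "finite K \<Longrightarrow> finite L \<Longrightarrow> K \<inter> L = {} \<Longrightarrow> set_encode (K \<union> L) = set_encode K + set_encode L"
  by (simp add: set_encode_def sum.union_disjoint)

text \<open>Let \<open>S = I \<inter> J\<close>, and consider the coordinate of the product at \<open>T\<close>, the symmetric difference of \<open>I\<close> and \<open>J\<close>. A term
  splits \<open>T\<close> into \<open>K\<close> and \<open>T - K\<close>, and by the maximality of \<open>I\<close> and \<open>J\<close> it vanishes unless \<open>K\<close> weighs
  at most as much as \<open>I - S\<close> and \<open>T - K\<close> at most as much as \<open>J - S\<close>. The total weight is the same
  for all splittings, so both are equalities and only \<open>K = I - S\<close> survives.\<close>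

lemma contract_leading:
  assumes f: "leading f I" and g: "leading g J"
  shows "wedge (contract (I \<inter> J) f) (contract (I \<inter> J) g) \<noteq> (\<lambda>T. 0)"
proof
  assume zero: "wedge (contract (I \<inter> J) f) (contract (I \<inter> J) g) = (\<lambda>T. 0)"
  define S where "S = I \<inter> J"
  define T where "T = (I - S) \<union> (J - S)"
  have fin: "finite I" "finite J" "finite S" "finite T"
    using f g by (auto simp: leading_def S_def T_def)
  have TI: "T - (I - S) = J - S" "(I - S) \<union> S = I" "(J - S) \<union> S = J" by (auto simp: T_def S_def)
  have only: "inv_sign K (T - K) * contract S f K * contract S g (T - K) = 0"
    if K: "K \<subseteq> T" "K \<noteq> I - S" for K
  proof (rule ccontr)
    assume nz: "inv_sign K (T - K) * contract S f K * contract S g (T - K) \<noteq> 0"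
    have finK: "finite K" "finite (T - K)" using K fin finite_subset by auto
    have disj: "K \<inter> S = {}" "(T - K) \<inter> S = {}" using K by (auto simp: T_def)
    have "f (K \<union> S) \<noteq> 0" "g ((T - K) \<union> S) \<noteq> 0" using nz disj by (auto simp: contract_def)
    then have "set_encode (K \<union> S) \<le> set_encode I" "set_encode ((T - K) \<union> S) \<le> set_encode J"
      using f g by (auto simp: leading_def)
    moreover have "set_encode (K \<union> S) = set_encode K + set_encode S"
      "set_encode ((T - K) \<union> S) = set_encode (T - K) + set_encode S"
      using set_encode_Un disj finK fin by blast+
    moreover have "set_encode T = set_encode K + set_encode (T - K)"
      using set_encode_Un[of K "T - K"] finK K by (simp add: Un_absorb1)
    moreover have "set_encode T = set_encode (I - S) + set_encode (J - S)"
      unfolding T_def using fin by (intro set_encode_Un) (auto simp: S_def)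
    moreover have "set_encode I = set_encode (I - S) + set_encode S"
      "set_encode J = set_encode (J - S) + set_encode S"
      using set_encode_Un[of "I - S" S] set_encode_Un[of "J - S" S] fin TI by auto
    ultimately have "set_encode (K \<union> S) = set_encode I" by linarith
    then have "K \<union> S = I" using set_encode_eq[of "K \<union> S" I] finK fin by simp
    then show False using K disj by auto
  qed
  have "wedge (contract S f) (contract S g) T
      = (\<Sum>K\<in>{I - S}. inv_sign K (T - K) * contract S f K * contract S g (T - K))"
    unfolding wedge_def using fin only by (intro sum.mono_neutral_right) (auto simp: T_def)
  also have "\<dots> = inv_sign (I - S) (J - S) * f I * g J"
    using TI by (simp add: contract_def Diff_Int_distrib2)
  also have "\<dots> \<noteq> 0" using f g by (simp add: leading_def inv_sign_nonzero)
  finally show False using zero unfolding S_def by simp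
qed

text \<open>If there were fewer leading sets than the \<open>\<alpha> i\<close>, a nontrivial combination of the \<open>\<alpha> i\<close> would
  vanish at all leading sets, in particular at its own.\<close>

lemma card_le_leading_sets:
  fixes \<alpha> :: "'i \<Rightarrow> nat set \<Rightarrow> real"
  assumes I: "finite I" and N: "finite N" "\<And>i K. i \<in> I \<Longrightarrow> \<alpha> i K \<noteq> 0 \<Longrightarrow> K \<subseteq> N"
    and indep: "\<And>r. (\<lambda>K. \<Sum>i\<in>I. r i * \<alpha> i K) = (\<lambda>K. 0) \<Longrightarrow> \<forall>i\<in>I. r i = 0"
  shows "card I \<le> card {K. \<exists>r. leading (\<lambda>K. \<Sum>i\<in>I. r i * \<alpha> i K) K}"
proof (rule ccontr)
  let ?L = "{K. \<exists>r. leading (\<lambda>K. \<Sum>i\<in>I. r i * \<alpha> i K) K}"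
  have supp: "K \<subseteq> N" if "(\<Sum>i\<in>I. r i * \<alpha> i K) \<noteq> 0" for r K
    using that N(2) by (metis (no_types, lifting) mult_zero_right sum.neutral)
  have "?L \<subseteq> Pow N" using supp by (auto simp: leading_def)
  then have "finite ?L" using N(1) finite_subset by blast
  moreover assume "\<not> card I \<le> card ?L"
  ultimately obtain r where r: "\<exists>i\<in>I. r i \<noteq> 0" "\<forall>K\<in>?L. (\<Sum>i\<in>I. r i * \<alpha> i K) = 0"
    using homogeneous_system[of ?L I \<alpha>] I by auto
  let ?f = "\<lambda>K. \<Sum>i\<in>I. r i * \<alpha> i K"
  have "?f \<noteq> (\<lambda>K. 0)" using indep[of r] r(1) by blast
  then obtain K where K: "leading ?f K" using leading_exists[of N ?f] N(1) supp by blast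
  then have "K \<in> ?L" by blast
  then show False using r(2) K by (auto simp: leading_def)
qed

text \<open>The products of contractions vanish on the generators, hence by bilinearity on all pairs of
  combinations; for \<open>S = K \<inter> L\<close> this would contradict \<open>contract_leading\<close>.\<close>

lemma leading_sets_intersecting:
  assumes xs: "\<And>i j. i \<in> I \<Longrightarrow> j \<in> I \<Longrightarrow> t \<le> card (set (xs i) \<inter> set (xs j))"
    and K: "leading (\<lambda>K. \<Sum>i\<in>I. r i * wedge_list v (xs i) K) K"
    and L: "leading (\<lambda>K. \<Sum>i\<in>I. s i * wedge_list v (xs i) K) L"
  shows "t \<le> card (K \<inter> L)"
proof (rule ccontr)
  assume "\<not> ?thesis"
  then have less: "card (K \<inter> L) < card (set (xs i) \<inter> set (xs j))" if "i \<in> I" "j \<in> I" for i j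
    using xs[OF that] by simp
  have fin: "finite (K \<inter> L)" using K by (simp add: leading_def)
  have lin: "contract S (\<lambda>K. \<Sum>i\<in>I. r i * wedge_list v (xs i) K)
      = (\<lambda>K. \<Sum>i\<in>I. r i * contract S (wedge_list v (xs i)) K)" for r S
    by (auto simp: contract_def fun_eq_iff)
  have "wedge (contract (K \<inter> L) (\<lambda>K. \<Sum>i\<in>I. r i * wedge_list v (xs i) K))
      (contract (K \<inter> L) (\<lambda>K. \<Sum>i\<in>I. s i * wedge_list v (xs i) K)) = (\<lambda>T. 0)"
    unfolding lin wedge_combination[abs_def]
    using contract_wedge_list_intersecting[OF fin less] by (simp add: wedge_combination fun_eq_iff)
  then show False using contract_leading[OF K L] by blast
qed

section \<open>The bound on the number of pairs\<close>

lemma card_le_AK: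
  assumes "F \<subseteq> Pow {1..n}" "uniform a F" "t_intersecting t F"
  shows "card F \<le> AK n a t"
proof -
  have "{card F | F. F \<subseteq> Pow {1..n} \<and> uniform a F \<and> t_intersecting t F} \<subseteq> card ` Pow (Pow {1..n})"
    by auto
  then have "finite {card F | F. F \<subseteq> Pow {1..n} \<and> uniform a F \<and> t_intersecting t F}"
    by (rule finite_subset) simp
  then show ?thesis unfolding AK_def using assms by (intro Max_ge) auto
qed

text \<open>Pair a vanishing combination with \<open>\<beta> j\<close>, where \<open>j\<close> is the last index with a nonzero
  coefficient: the earlier terms vanish by skewness, the later ones by the choice of \<open>j\<close>.\<close>

lemma skew_pairing_independent:
  fixes \<alpha> \<beta> :: "nat \<Rightarrow> nat set \<Rightarrow> real"
  assumes diag: "\<And>i. i \<in> {1..m} \<Longrightarrow> wedge (\<alpha> i) (\<beta> i) \<noteq> (\<lambda>T. 0)"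
    and upper: "\<And>i j. 1 \<le> i \<Longrightarrow> i < j \<Longrightarrow> j \<le> m \<Longrightarrow> wedge (\<alpha> i) (\<beta> j) = (\<lambda>T. 0)"
    and zero: "(\<lambda>K. \<Sum>i\<in>{1..m}. r i * \<alpha> i K) = (\<lambda>K. 0)"
  shows "\<forall>i\<in>{1..m}. r i = 0"
proof (rule ccontr)
  assume "\<not> ?thesis"
  then have ne: "{i\<in>{1..m}. r i \<noteq> 0} \<noteq> {}" by auto
  define j where "j = Max {i\<in>{1..m}. r i \<noteq> 0}"
  have j: "j \<in> {1..m}" "r j \<noteq> 0" using Max_in[OF _ ne] by (auto simp: j_def)
  have after: "r i = 0" if "i \<in> {1..m}" "j < i" for i
    using that Max_ge[of "{i\<in>{1..m}. r i \<noteq> 0}" i] unfolding j_def by fastforce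
  have "r j * wedge (\<alpha> j) (\<beta> j) T = 0" for T
  proof -
    have "0 = wedge (\<lambda>K. \<Sum>i\<in>{1..m}. r i * \<alpha> i K) (\<lambda>K. \<Sum>i\<in>{j}. 1 * \<beta> i K) T"
      unfolding zero by (simp add: wedge_def)
    also have "\<dots> = (\<Sum>i\<in>{1..m}. r i * wedge (\<alpha> i) (\<beta> j) T)"
      unfolding wedge_combination by simp
    also have "\<dots> = (\<Sum>i\<in>{j}. r i * wedge (\<alpha> i) (\<beta> j) T)"
    proof (rule sum.mono_neutral_right)
      show "\<forall>i\<in>{1..m} - {j}. r i * wedge (\<alpha> i) (\<beta> j) T = 0"
      proof
        fix i assume i: "i \<in> {1..m} - {j}"
        then consider "i < j" | "j < i" by force
        then show "r i * wedge (\<alpha> i) (\<beta> j) T = 0"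
          using i j(1) upper[of i j] after[of i] by cases auto
      qed
    qed (use j in auto)
    finally show ?thesis by simp
  qed
  then show False using j diag[of j] by (auto simp: fun_eq_iff)
qed

theorem corollary5p2:
  fixes t a b m :: nat
    and A B :: "nat \<Rightarrow> 'v set"
  assumes "1 \<le> t" and "t \<le> a" and "a \<le> b"
    and "\<And>i. i \<in> {1..m} \<Longrightarrow> finite (A i) \<and> card (A i) = a"
    and "\<And>i. i \<in> {1..m} \<Longrightarrow> finite (B i) \<and> card (B i) = b"
    and "\<And>i. i \<in> {1..m} \<Longrightarrow> A i \<inter> B i = {}"
    and "\<And>i j. 1 \<le> i \<Longrightarrow> i < j \<Longrightarrow> j \<le> m \<Longrightarrow> A i \<inter> B j \<noteq> {}"
    and "\<And>i j. i \<in> {1..m} \<Longrightarrow> j \<in> {1..m} \<Longrightarrow> t \<le> card (A i \<inter> A j)"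
  shows "m \<le> AK (a + b) a t"
proof -
  let ?I = "{1..m}" and ?N = "{1..a + b}"
  define X where "X = (\<Union>i\<in>?I. A i \<union> B i)"
  have "finite X" unfolding X_def using assms(4,5) by auto
  then obtain v :: "'v \<Rightarrow> nat \<Rightarrow> real" where v0: "\<And>x k. k \<notin> ?N \<Longrightarrow> v x k = 0"
    and v: "\<And>xs. distinct xs \<Longrightarrow> set xs \<subseteq> X \<Longrightarrow> length xs \<le> a + b \<Longrightarrow> wedge_list v xs \<noteq> (\<lambda>T. 0)"
    using general_position[of X "a + b"] by blast
  have "\<exists>xs. set xs = A i \<and> distinct xs" "\<exists>ys. set ys = B i \<and> distinct ys" if "i \<in> ?I" for i
    using assms(4,5)[OF that] finite_distinct_list[of "A i"] finite_distinct_list[of "B i"] by auto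
  then obtain xs ys where xs: "\<And>i. i \<in> ?I \<Longrightarrow> set (xs i) = A i \<and> distinct (xs i)"
    and ys: "\<And>i. i \<in> ?I \<Longrightarrow> set (ys i) = B i \<and> distinct (ys i)" by metis
  have len: "length (xs i) = a" "length (ys i) = b" if "i \<in> ?I" for i
    using that xs ys assms(4,5) distinct_card by metis+
  define \<alpha> where "\<alpha> i = wedge_list v (xs i)" for i
  define \<beta> where "\<beta> i = wedge_list v (ys i)" for i
  define F where "F = {K. \<exists>r. leading (\<lambda>K. \<Sum>i\<in>?I. r i * \<alpha> i K) K}"
  have supp: "K \<subseteq> ?N \<and> finite K \<and> card K = a" if "i \<in> ?I" "\<alpha> i K \<noteq> 0" for i K
    using wedge_list_support[of "xs i" ?N v K] v0 that len by (auto simp: \<alpha>_def)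
  have "m = card ?I" by simp
  also have "\<dots> \<le> card F"
    unfolding F_def
  proof (rule card_le_leading_sets[where N="?N"])
    fix r assume "(\<lambda>K. \<Sum>i\<in>?I. r i * \<alpha> i K) = (\<lambda>K. 0)"
    then show "\<forall>i\<in>?I. r i = 0"
    proof (rule skew_pairing_independent[rotated 2])
      fix i assume i: "i \<in> ?I"
      show "wedge (\<alpha> i) (\<beta> i) \<noteq> (\<lambda>T. 0)"
        unfolding \<alpha>_def \<beta>_def wedge_list_append
        using i xs[OF i] ys[OF i] len[OF i] assms(6)[OF i] by (intro v) (auto simp: X_def)
    next
      fix i j assume ij: "1 \<le> i" "i < j" "j \<le> m"
      then show "wedge (\<alpha> i) (\<beta> j) = (\<lambda>T. 0)"
        unfolding \<alpha>_def \<beta>_def wedge_list_append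
        using xs[of i] ys[of j] assms(7)[of i j] by (intro wedge_list_not_distinct) auto
    qed
  next
    show "K \<subseteq> ?N" if "i \<in> ?I" "\<alpha> i K \<noteq> 0" for i K using supp[OF that] by blast
  qed (rule finite_atLeastAtMost)+
  also have "\<dots> \<le> AK (a + b) a t"
  proof (rule card_le_AK)
    have F: "K \<subseteq> ?N \<and> finite K \<and> card K = a" if KF: "K \<in> F" for K
    proof -
      obtain r where "(\<Sum>i\<in>?I. r i * \<alpha> i K) \<noteq> 0"
        using KF unfolding F_def leading_def by blast
      then obtain i where "i \<in> ?I" "r i * \<alpha> i K \<noteq> 0"
        by (rule sum.not_neutral_contains_not_neutral)
      then show ?thesis using supp[of i K] by simp
    qed
    show "F \<subseteq> Pow ?N" "uniform a F" using F by (auto simp: uniform_def)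
    have "t \<le> card (set (xs i) \<inter> set (xs j))" if "i \<in> ?I" "j \<in> ?I" for i j
      using assms(8) xs that by simp
    then have "t \<le> card (K \<inter> L)" if "K \<in> F" "L \<in> F" for K L
      using that leading_sets_intersecting[of ?I t xs _ v K _ L] unfolding F_def \<alpha>_def mem_Collect_eq
      by blast
    then show "t_intersecting t F" by (simp add: t_intersecting_def)
  qed
  finally show ?thesis .
qed

end
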